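(* If $n$ is a positive integer, then $\mathcal{P}(P_n) = p_n$ and $\mathcal{Q}(P_n) = q_n$, where $P_n$ is the path graph on $n$ vertices, $$p_n = \frac{1}{2} - \frac{1}{n}\cdot\frac{(-2)^n}{n!} + \frac{n+2}{2n}\sum_{j=0}^{n}\frac{(-2)^j}{j!},\qquad q_n = \frac{n-1}{2n} - \frac{1}{n}\cdot\frac{(-2)^n}{n!} + \frac{n+3}{2n}\sum_{j=0}^{n}\frac{(-2)^j}{j!},$$ and $\mathcal{P}$, $\mathcal{Q}$ are the winning probabilities of an optimal player moving first, respectively second, in the tree search game against a uniformly random opponent.
   Context: A tree is a connected acyclic undirected graph with a finite, positive number of vertices; $|T|$ is the number of vertices of $T$; $T\smallsetminus v$ is the forest obtained by deleting $v$ and its incident edges. Tree search game on $T$: one vertex of $T$ is selected uniformly at random as the target, unknown to both players. The players alternately guess vertices. If the guess $v$ is the target, the player who made it wins. Otherwise both players are informed which component of $T\smallsetminus v$ contains the target, and the game continues on that component with the other player to move. Here one player plays to maximize their probability of winning, while the opponent always guesses a vertex uniformly at random from among the vertices that could still be the target. $\mathcal{P}(T)$ (resp. $\mathcal{Q}(T)$) is the probability that the optimal player wins when the optimal player moves first (resp. second) on $T$. Equivalently, with $n=|T|$, they are determined recursively by $$\mathcal{P}(T)=\max_{v\in V(T)}\Bigl(\frac1n+\frac1n\sum_{T'}|T'|\,\mathcal{Q}(T')\Bigr),\qquad \mathcal{Q}(T)=\frac1{n^2}\sum_{v\in V(T)}\sum_{T'}|T'|\,\mathcal{P}(T'),$$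 where $T'$ ranges over the components of $T\smallsetminus v$ (empty sums are $0$). *)

theory Defs
  imports "HOL-Probability.Probability"
begin

text \<open>
  A graph is given by a vertex set \<open>V\<close> and a set \<open>E\<close> of two-element edges. All graphs arising from
  a graph by deleting vertices are induced subgraphs, so they are represented by their vertex sets
  \<open>S \<subseteq> V\<close> alone, with \<open>E\<close> fixed.
\<close>

definition component :: "'a set set \<Rightarrow> 'a set \<Rightarrow> 'a \<Rightarrow> 'a set" where
  "component E S t = {w \<in> S. (t, w) \<in> {(x, y). x \<in> S \<and> y \<in> S \<and> {x, y} \<in> E}\<^sup>*}"

definition is_cycle :: "'a set set \<Rightarrow> 'a list \<Rightarrow> bool" where
  "is_cycle E cs \<longleftrightarrow> 3 \<le> length cs \<and> distinct cs \<and>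
     (\<forall>i<length cs. {cs ! i, cs ! (Suc i mod length cs)} \<in> E)"

definition is_tree :: "'a set \<Rightarrow> 'a set set \<Rightarrow> bool" where
  "is_tree V E \<longleftrightarrow> finite V \<and> V \<noteq> {} \<and> E \<subseteq> {e. e \<subseteq> V \<and> card e = 2} \<and>
     (\<forall>u\<in>V. component E V u = V) \<and> (\<nexists>cs. is_cycle E cs)"

text \<open>
  A strategy selects a (possibly randomised) guess from the history of the game and the set \<open>S\<close> of
  vertices that could still be the target. The history lists all previous guesses, of both players,
  each with the vertex set of the component announced in reply.
\<close>

type_synonym 'a strategy = "('a \<times> 'a set) list \<Rightarrow> 'a set \<Rightarrow> 'a pmf"

definition strategies :: "'a strategy set" where
  "strategies = {\<sigma>. \<forall>h S. finite S \<and> S \<noteq> {} \<longrightarrow> set_pmf (\<sigma> h S) \<subseteq> S}"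

text \<open>
  The distribution of the event that the player following \<open>\<sigma>\<close> wins, when the target is \<open>t\<close>, the
  remaining vertices are \<open>S\<close>, and \<open>my_turn\<close> says whether it is this player's turn. The opponent
  guesses uniformly at random in \<open>S\<close>. The last \<open>else\<close> branches are never reached for
  \<open>\<sigma> \<in> strategies\<close> and finite \<open>S\<close> containing \<open>t\<close>; they only ensure termination.
\<close>

function play ::
  "'a set set \<Rightarrow> 'a strategy \<Rightarrow> 'a \<Rightarrow> bool \<Rightarrow> ('a \<times> 'a set) list \<Rightarrow> 'a set \<Rightarrow> bool pmf" where
  "play E \<sigma> t my_turn h S =
     bind_pmf (if my_turn then \<sigma> h S else pmf_of_set S) (\<lambda>v.
       if v = t then return_pmf my_turn
       else if finite S \<and> v \<in> S then
         (let S' = component E (S - {v}) t in play E \<sigma> t (\<not> my_turn) (h @ [(v, S')]) S')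
       else return_pmf False)"
  by pat_completeness auto
termination
proof (relation "Wellfounded.measure (\<lambda>(E, \<sigma>, t, my_turn, h, S). card S)", goal_cases)
  case (2 E \<sigma> t my_turn h S v S')
  have "S' \<subseteq> S - {v}" unfolding 2 component_def by blast
  then have "S' \<subset> S" using 2 by blast
  then show ?case using 2 by (auto intro: psubset_card_mono)
qed auto

declare play.simps [simp del]

text \<open>The whole game, starting with the selection of a uniformly random target.\<close>

definition tree_search_game :: "'a set \<Rightarrow> 'a set set \<Rightarrow> 'a strategy \<Rightarrow> bool \<Rightarrow> bool pmf" where
  "tree_search_game V E \<sigma> my_turn =
     bind_pmf (pmf_of_set V) (\<lambda>t. play E \<sigma> t my_turn [] V)"

text \<open>
  The winning probabilities of an optimal player moving first and second, respectively; these make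
  sense for any finite graph, and for trees the game is the tree search game.
\<close>

definition win_prob_first :: "'a set \<Rightarrow> 'a set set \<Rightarrow> real" where
  "win_prob_first V E = (SUP \<sigma>\<in>strategies. pmf (tree_search_game V E \<sigma> True) True)"

definition win_prob_second :: "'a set \<Rightarrow> 'a set set \<Rightarrow> real" where
  "win_prob_second V E = (SUP \<sigma>\<in>strategies. pmf (tree_search_game V E \<sigma> False) True)"

definition path_verts :: "nat \<Rightarrow> nat set" where
  "path_verts n = {1..n}"

definition path_edges :: "nat \<Rightarrow> nat set set" where
  "path_edges n = {{i, i + 1} | i. 1 \<le> i \<and> i < n}"

lemma path_edges_iff:
  "{x, y} \<in> path_edges n \<longleftrightarrow> 1 \<le> x \<and> 1 \<le> y \<and> x \<le> n \<and> y \<le> n \<and> (y = Suc x \<or> x = Suc y)"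
  by (auto simp: path_edges_def doubleton_eq_iff)

lemma no_cycle_path: "\<not> is_cycle (path_edges n) cs"
proof
  assume c: "is_cycle (path_edges n) cs"
  define l where "l = length cs"
  have l: "3 \<le> l" and d: "distinct cs"
    and e: "\<And>i. i < l \<Longrightarrow> cs ! (Suc i mod l) = Suc (cs ! i) \<or> cs ! i = Suc (cs ! (Suc i mod l))"
    using c unfolding is_cycle_def l_def path_edges_iff by auto
  have "Max (set cs) \<in> set cs" using l l_def by (intro Max_in) auto
  then obtain i where i: "i < l" "cs ! i = Max (set cs)" by (auto simp: in_set_conv_nth l_def)
  have mx: "cs ! j \<le> cs ! i" if "j < l" for j using that i l_def by auto
  define a where "a = Suc i mod l"
  define b where "b = (if i = 0 then l - 1 else i - 1)"
  have a: "a < l" and b: "b < l" "Suc b mod l = i" using i l by (auto simp: a_def b_def)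
  have "cs ! i = Suc (cs ! a)" using e[OF i(1)] mx[OF a] by (auto simp: a_def)
  moreover have "cs ! i = Suc (cs ! b)" using e[OF b(1)] mx[OF b(1)] b(2) by auto
  ultimately have "a = b" using d a b(1) l_def by (simp add: nth_eq_iff_index_eq)
  then show False using i(1) l by (auto simp: a_def b_def mod_Suc split: if_splits)
qed

lemma is_tree_path:
  assumes "n \<ge> 1"
  shows "is_tree (path_verts n) (path_edges n)"
proof -
  let ?R = "{(x, y). x \<in> path_verts n \<and> y \<in> path_verts n \<and> {x, y} \<in> path_edges n}"
  have s: "sym ?R" by (auto simp: sym_def insert_commute)
  have r: "(1, v) \<in> ?R\<^sup>*" if "1 \<le> v" "v \<le> n" for v
    using that
  proof (induction v rule: dec_induct)
    case (step m)
    then have "(m, Suc m) \<in> ?R" by (auto simp: path_verts_def path_edges_iff)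
    then show ?case using step by (meson Suc_leD rtrancl.rtrancl_into_rtrancl)
  qed simp
  have "(u, v) \<in> ?R\<^sup>*" if "u \<in> path_verts n" "v \<in> path_verts n" for u v
  proof -
    have "(u, 1) \<in> ?R\<^sup>*" using r[of u] that s
      by (auto simp: path_verts_def dest: sym_rtrancl symD)
    also have "(1, v) \<in> ?R\<^sup>*" using r[of v] that by (auto simp: path_verts_def)
    finally show ?thesis .
  qed
  then have "\<forall>u\<in>path_verts n. component (path_edges n) (path_verts n) u = path_verts n"
    unfolding component_def by blast
  then show ?thesis using assms no_cycle_path
    by (auto simp: is_tree_def path_verts_def path_edges_def)
qed

end

theory Submission
  imports Defs
begin

text \<open>
  Multiply all winning probabilities by the number of vertices, so that they become sums over the
  possible targets (``scores''). Let \<open>a\<^sub>n\<close> and \<open>b\<^sub>n\<close> be the optimal scores on \<open>P\<^sub>n\<close> when moving first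
  and second. Guessing a vertex \<open>v\<close> of a path leaves a path on either side of \<open>v\<close>, and the score is
  additive over the targets, so
  \<open>a\<^sub>n = 1 + max {b\<^sub>i + b\<^sub>j | i + j = n - 1}\<close> and, because a uniform guess makes each of the two pieces
  equally likely to have any size below \<open>n\<close>, \<open>n b\<^sub>n = 2 (a\<^sub>0 + \<dots> + a\<^sub>n\<^sub>-\<^sub>1)\<close>.

  The claim is that guessing an endpoint is always optimal, that is \<open>a\<^sub>n = 1 + b\<^sub>n\<^sub>-\<^sub>1\<close>. Granting this,
  the sum telescopes to \<open>(n + 2) b\<^sub>n\<^sub>+\<^sub>2 = (n + 1) b\<^sub>n\<^sub>+\<^sub>1 + 2 + 2 b\<^sub>n\<close>, and the stated formulas solve this
  recurrence. Therefore \<open>b\<close> is defined below by the recurrence, as \<open>second_score\<close>, and \<open>a\<close>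
  in terms of it, as \<open>first_score\<close>. What has to be
  shown about \<open>b\<close> is superadditivity, \<open>b\<^sub>i + b\<^sub>j \<le> b\<^sub>i\<^sub>+\<^sub>j\<close> (\<open>second_score_superadditive\<close>), which says that
  splitting the path never beats keeping it in one piece.

  Superadditivity is tight (\<open>b\<^sub>2 + b\<^sub>2 = b\<^sub>4\<close>), so it needs some care. The increments
  \<open>d\<^sub>n = b\<^sub>n\<^sub>+\<^sub>1 - b\<^sub>n\<close> satisfy \<open>(n + 3) d\<^sub>n\<^sub>+\<^sub>2 = (n + 1) d\<^sub>n\<^sub>+\<^sub>1 + 2 d\<^sub>n\<close>: each is a weighted average of the
  previous two. Hence all later increments lie between any two consecutive ones, and the distance
  of consecutive ones decays faster than geometrically. This confines the increments to such a
  narrow range that only splits with a piece of at most two vertices need separate treatment.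

  Finally, the scores of actual strategies, which may be randomised and may depend on the whole
  history, are compared with \<open>a\<close> and \<open>b\<close> by induction on the length of the interval of remaining
  vertices: they never exceed them (\<open>interval_score_le\<close>), and always guessing the leftmost remaining
  vertex attains them (\<open>interval_score_leftmost\<close>).
\<close>

section \<open>The recurrence and its closed form\<close>

text \<open>
  The optimal scores, i.e. \<open>n\<close> times the winning probabilities on \<open>P\<^sub>n\<close>, for the player moving second
  and first. The recurrence is the one obtained from the assumption that endpoints are optimal
  guesses; that this is the value of the game is only established at the end. The value 0 at \<open>n = 0\<close>
  makes an empty piece, which occurs when the guess is an endpoint, contribute nothing.
\<close>
fun second_score :: "nat \<Rightarrow> real" where
  "second_score 0 = 0"
| "second_score (Suc 0) = 0"
| "second_score (Suc (Suc n)) =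
    ((real n + 1) * second_score (Suc n) + 2 + 2 * second_score n) / (real n + 2)"

definition first_score :: "nat \<Rightarrow> real" where
  "first_score n = (if n = 0 then 0 else 1 + second_score (n - 1))"

text \<open>
  This form, with the sum over the sizes of the two pieces, is what an opponent's uniform guess
  produces; the recurrence is the difference of two consecutive instances.
\<close>
lemma second_score_sum: "real m * second_score m = 2 * (\<Sum>k<m. first_score k)"
proof (induction m rule: second_score.induct)
  case (3 n)
  have "real (Suc (Suc n)) * second_score (Suc (Suc n))
      = real (Suc n) * second_score (Suc n) + 2 * first_score (Suc n)"
    by (simp add: first_score_def divide_simps) (simp add: algebra_simps)
  then show ?case using 3(1) by (simp del: second_score.simps)
qed (simp_all add: first_score_def)

lemma second_score_closed:
  "second_score n = (real n - 1) / 2 - (- 2) ^ n / fact n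
     + (real n + 3) / 2 * (\<Sum>j=0..n. (- 2) ^ j / fact j)"
proof (induction n rule: second_score.induct)
  case (3 n)
  define x :: real where "x = (- 2) ^ n / fact n"
  define s :: real where "s = (\<Sum>j=0..n. (- 2) ^ j / fact j)"
  have x1: "(- 2) ^ Suc n / fact (Suc n) = - 2 * x / (real n + 1)"
    by (simp add: x_def field_simps)
  have x2: "(- 2) ^ Suc (Suc n) / fact (Suc (Suc n)) = 4 * x / ((real n + 1) * (real n + 2))"
    by (simp add: x_def field_simps)
  have s1: "(\<Sum>j=0..Suc n. (- 2) ^ j / fact j) = s - 2 * x / (real n + 1)"
    unfolding sum.atLeast0_atMost_Suc x1 s_def by simp
  have s2: "(\<Sum>j=0..Suc (Suc n). (- 2) ^ j / fact j)
      = s - 2 * x / (real n + 1) + 4 * x / ((real n + 1) * (real n + 2))"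
    unfolding sum.atLeast0_atMost_Suc[of _ "Suc n"] s1 x2 ..
  \<comment> \<open>Only for the field arithmetic: the denominators become \<open>u\<close> and \<open>u + 1\<close>.\<close>
  define u where "u = real n + 1"
  have u: "u > 0" "real n = u - 1" by (auto simp: u_def)
  have e: "u + 1 \<noteq> 0" "u \<noteq> 0" using u by auto
  show ?case unfolding second_score.simps(3) 3 s2 x2 s1 x1 x_def[symmetric] s_def[symmetric]
    using e by (simp add: u(2) divide_simps) (simp add: algebra_simps)
qed simp_all

text \<open>
  Since \<open>a\<^sub>n = 1 + b\<^sub>n\<^sub>-\<^sub>1\<close>, this is the preceding formula with its index shifted. The partial sums for
  \<open>n\<close> and \<open>n - 1\<close> differ by \<open>(-2)\<^sup>n / n!\<close>, and so all of the shift is absorbed into multiples of this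
  term, which cancel.
\<close>
lemma first_score_closed:
  assumes "n \<ge> 1"
  shows "first_score n = real n / 2 - (- 2) ^ n / fact n
     + (real n + 2) / 2 * (\<Sum>j=0..n. (- 2) ^ j / fact j)"
proof -
  obtain k where n: "n = Suc k" using assms by (cases n) auto
  define x :: real where "x = (- 2) ^ n / fact n"
  define s :: real where "s = (\<Sum>j=0..k. (- 2) ^ j / fact j)"
  have xk: "(- 2) ^ k / fact k = - (real k + 1) / 2 * x"
    by (simp add: x_def n divide_simps) (simp add: algebra_simps)
  have sn: "(\<Sum>j=0..n. (- 2) ^ j / fact j) = s + x"
    unfolding s_def x_def n sum.atLeast0_atMost_Suc ..
  have "first_score n = 1 + second_score k" by (simp add: first_score_def n)
  then show ?thesis
    unfolding second_score_closed xk sn x_def[symmetric] s_def[symmetric]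
    by (simp add: n field_simps)
qed

section \<open>Superadditivity\<close>

definition gain :: "nat \<Rightarrow> real" where
  "gain n = second_score (Suc n) - second_score n"

text \<open>
  The difference of two consecutive instances of the recurrence for \<open>second_score\<close>. The coefficients
  on the right add up to the one on the left, so it expresses an increment as a weighted average of
  the two before it; this is the source of all estimates below.
\<close>
lemma gain_rec: "(real n + 3) * gain (n + 2) = (real n + 1) * gain (n + 1) + 2 * gain n"
proof -
  have e: "real n + 2 \<noteq> 0" "real n + 3 \<noteq> 0" by auto
  show ?thesis using e
    by (simp add: gain_def numeral_2_eq_2 divide_simps) (simp add: algebra_simps)
qed

text \<open>An interval containing two consecutive increments is convex, so by averaging it contains all
  later ones.\<close>
lemma gain_between:
  assumes "k \<le> m"
  shows "gain m \<in> {min (gain k) (gain (k + 1))..max (gain k) (gain (k + 1))}"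
  using assms
proof (induction m rule: less_induct)
  case (less m)
  show ?case
  proof (cases "m = k \<or> m = k + 1")
    case False
    define j where "j = m - 2"
    have j: "m = j + 2" "k \<le> j" using False less.prems by (auto simp: j_def)
    have "convex {min (gain k) (gain (k + 1))..max (gain k) (gain (k + 1))}" by simp
    then have "((real j + 1) / (real j + 3)) *\<^sub>R gain (j + 1) + (2 / (real j + 3)) *\<^sub>R gain j
        \<in> {min (gain k) (gain (k + 1))..max (gain k) (gain (k + 1))}"
      by (rule convexD) (use less.IH[of j] less.IH[of "j + 1"] j in
          \<open>auto simp: add_divide_distrib[symmetric]\<close>)
    also have "((real j + 1) / (real j + 3)) *\<^sub>R gain (j + 1) + (2 / (real j + 3)) *\<^sub>R gain j = gain m"
    proof -
      have "((real j + 1) / (real j + 3)) *\<^sub>R gain (j + 1) + (2 / (real j + 3)) *\<^sub>R gain j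
          = ((real j + 3) * gain (j + 2)) / (real j + 3)"
        by (simp only: gain_rec real_scaleR_def times_divide_eq_left
            add_divide_distrib[of "(real j + 1) * gain (j + 1)"])
      then show ?thesis by (simp add: j)
    qed
    finally show ?thesis .
  qed auto
qed

lemma gain_values: "gain 0 = 0" "gain (Suc 0) = 1" "gain 2 = 1 / 3" "gain 3 = 2 / 3" "gain 4 = 8 / 15"
  by (simp_all add: gain_def eval_nat_numeral)

text \<open>
  By averaging, the difference of consecutive increments is multiplied by \<open>- 2 / (n + 3)\<close> in each
  step, which from \<open>n = 3\<close> on is at most \<open>1 / 3\<close> in absolute value. The start at index 3 gives the
  constant \<open>2 / 15 = d\<^sub>3 - d\<^sub>4\<close>.
\<close>
lemma gain_step: "\<bar>gain (k + 4) - gain (k + 3)\<bar> \<le> 2 / 15 * (1 / 3) ^ k"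
proof (induction k)
  case (Suc k)
  have "gain (k + 5) - gain (k + 4) = - 2 / (real k + 6) * (gain (k + 4) - gain (k + 3))"
    using gain_rec[of "k + 3"] by (simp add: field_simps)
  then have "\<bar>gain (k + 5) - gain (k + 4)\<bar> = 2 / (real k + 6) * \<bar>gain (k + 4) - gain (k + 3)\<bar>"
    by (simp add: abs_mult del: times_divide_eq_left)
  also have "\<dots> \<le> 1 / 3 * (2 / 15 * (1 / 3) ^ k)"
    using Suc by (intro mult_mono) (auto simp: field_simps)
  finally show ?case by (simp add: add.commute)
qed (simp add: gain_values)

text \<open>
  The induction is on the length of one piece. Three vertices leave a gap of at least
  \<open>3 \<cdot> 8/15 - b\<^sub>3 = 4/15\<close>, and lengthening the piece from \<open>i + 3\<close> to \<open>i + 4\<close> changes the gap by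
  \<open>d\<^sub>i\<^sub>+\<^sub>3\<^sub>+\<^sub>j - d\<^sub>i\<^sub>+\<^sub>3\<close>, which is at least \<open>- (2/15) (1/3)\<^sup>i\<close>. These losses add up to at most
  \<open>1/5 < 4/15\<close>. The bound in the lemma is \<open>4/15\<close> minus the losses so far, written as the final
  reserve \<open>1/15\<close> plus the tail of the geometric series, so that the induction goes through.
\<close>
lemma second_score_superadditive_gap:
  assumes "3 \<le> j"
  shows "second_score (i + 3 + j) - second_score (i + 3) - second_score j
    \<ge> 1 / 15 + 1 / 5 * (1 / 3) ^ i"
proof (induction i)
  case 0
  have "gain m \<ge> 8 / 15" if "m \<ge> 3" for m
    using gain_between[OF that] by (simp add: gain_values)
  from this[of j] this[of "j + 1"] this[of "j + 2"]
  have "gain j + gain (j + 1) + gain (j + 2) \<ge> 8 / 5"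
    using assms by simp
  also have "gain j + gain (j + 1) + gain (j + 2) = second_score (j + 3) - second_score j"
    by (simp add: gain_def numeral_2_eq_2 numeral_3_eq_3 del: second_score.simps)
  finally have "second_score (j + 3) - second_score j \<ge> 8 / 5" .
  moreover have "second_score 3 = 4 / 3" by (simp add: eval_nat_numeral)
  ultimately show ?case by (simp add: add.commute)
next
  case (Suc i)
  have "gain (i + 3 + j) - gain (i + 3) \<ge> - (2 / 15 * (1 / 3) ^ i)"
    using gain_between[of "i + 3" "i + 3 + j"] gain_step[of i]
    by (auto simp: min_def max_def abs_if algebra_simps split: if_splits)
  then show ?case using Suc by (simp add: gain_def add_ac)
qed

text \<open>
  When one piece has at most two vertices, the reserve used above is missing, but the claim
  reduces to facts about one or two increments: \<open>b\<^sub>1 = 0\<close> requires \<open>0 \<le> d\<^sub>j\<close>, and \<open>b\<^sub>2 = 1\<close> requires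
  \<open>1 \<le> d\<^sub>j + d\<^sub>j\<^sub>+\<^sub>1\<close>.
\<close>
lemma second_score_superadditive: "second_score i + second_score j \<le> second_score (i + j)"
proof -
  have nonneg: "gain m \<ge> 0" for m using gain_between[of 0 m] by (simp add: gain_values)
  have pair: "gain m + gain (m + 1) \<ge> 1" for m
  proof (cases "m \<ge> 3")
    case True
    then show ?thesis using gain_between[of 3 m] gain_between[of 3 "m + 1"]
      by (simp add: gain_values)
  next
    case False
    then have "m = 0 \<or> m = 1 \<or> m = 2" by auto
    then show ?thesis using gain_values by (auto simp: numeral_2_eq_2 numeral_3_eq_3)
  qed
  have small: "second_score i + second_score j \<le> second_score (i + j)" if i: "i < 3" for i j
  proof -
    from i have "i = 0 \<or> i = 1 \<or> i = 2" by auto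
    then show ?thesis
      by (elim disjE) (use nonneg[of j] pair[of j] in \<open>auto simp: gain_def numeral_2_eq_2\<close>)
  qed
  show ?thesis
  proof (cases "i < 3 \<or> j < 3")
    case True
    then show ?thesis using small[of i j] small[of j i] by (auto simp: add.commute)
  next
    case False
    have "0 \<le> 1 / 15 + 1 / 5 * (1 / 3 :: real) ^ (i - 3)" by simp
    also have "\<dots> \<le> second_score (i + j) - second_score i - second_score j"
      using second_score_superadditive_gap[of j "i - 3"] False by simp
    finally show ?thesis by simp
  qed
qed

section \<open>Components of a path after deletions\<close>

text \<open>
  An interval of remaining vertices is connected, and no edge leaves it if the vertices just
  beyond its two ends are gone.
\<close>
lemma component_path_interval:
  assumes A: "{l..<r} \<subseteq> S" and S: "S \<subseteq> {1..n}" and t: "t \<in> {l..<r}"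
    and sep: "r \<notin> S" "\<And>x. x \<in> S \<Longrightarrow> Suc x \<noteq> l"
  shows "component (path_edges n) S t = {l..<r}"
proof -
  let ?R = "{(x, y). x \<in> S \<and> y \<in> S \<and> {x, y} \<in> path_edges n}"
  have s: "sym ?R" by (auto simp: sym_def insert_commute)
  have up: "(x, y) \<in> ?R\<^sup>*" if "l \<le> x" "x \<le> y" "y < r" for x y
    using that(2,3)
  proof (induction y rule: dec_induct)
    case (step m)
    then have "m \<in> {l..<r}" "Suc m \<in> {l..<r}" using that(1) by auto
    then have "m \<in> S" "Suc m \<in> S" using A by blast+
    moreover from this S have "m \<in> {1..n}" "Suc m \<in> {1..n}" by blast+
    ultimately have "(m, Suc m) \<in> ?R" by (simp add: path_edges_iff)
    then show ?case using step by (meson Suc_lessD rtrancl.rtrancl_into_rtrancl)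
  qed simp
  have "(t, w) \<in> ?R\<^sup>*" if "w \<in> {l..<r}" for w
    using up[of t w] up[of w t] sym_rtrancl[OF s] t that by (cases "t \<le> w") (auto dest: symD)
  moreover have "w \<in> {l..<r}" if "(t, w) \<in> ?R\<^sup>*" for w
    using that
  proof (induction rule: rtrancl_induct)
    case (step y z)
    have "z \<in> S" "y \<in> S" "z = Suc y \<or> y = Suc z"
      using step.hyps by (auto simp: path_edges_iff)
    moreover from this sep(1) have "z \<noteq> r" by blast
    ultimately show ?case using step.IH sep(2)[of z] by (auto simp: le_less)
  qed (rule t)
  ultimately show ?thesis using A unfolding component_def by blast
qed

section \<open>The game on intervals\<close>

text \<open>
  Sums over the targets rather than averages, because sums are additive over the two pieces left by
  a guess. The history is a parameter because the strategy may depend on it.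
\<close>
definition interval_score ::
  "nat \<Rightarrow> nat strategy \<Rightarrow> bool \<Rightarrow> (nat \<times> nat set) list \<Rightarrow> nat \<Rightarrow> nat \<Rightarrow> real" where
  "interval_score n \<sigma> my_turn h l r =
     (\<Sum>t\<in>{l..<r}. pmf (play (path_edges n) \<sigma> t my_turn h {l..<r}) True)"

text \<open>
  One round of the game. A guess \<open>v\<close> scores the target \<open>v\<close> for the player who makes it; all other
  targets are scored in the subgame on their component. All targets in the same piece lead to the same
  announced component and hence to the same history, so their contributions form the score of
  a single subgame.
\<close>
lemma interval_score_step:
  assumes \<sigma>: "\<sigma> \<in> strategies" and lr: "1 \<le> l" "l < r" "r \<le> Suc n"
  shows "interval_score n \<sigma> my_turn h l r =
    (\<Sum>v\<in>{l..<r}. pmf (if my_turn then \<sigma> h {l..<r} else pmf_of_set {l..<r}) v *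
       (of_bool my_turn + interval_score n \<sigma> (\<not> my_turn) (h @ [(v, {l..<v})]) l v
          + interval_score n \<sigma> (\<not> my_turn) (h @ [(v, {Suc v..<r})]) (Suc v) r))"
proof -
  let ?S = "{l..<r}"
  let ?E = "path_edges n"
  let ?M = "if my_turn then \<sigma> h ?S else pmf_of_set ?S"
  define g where "g v t = pmf (if v = t then return_pmf my_turn
       else let S' = component ?E (?S - {v}) t in
         play ?E \<sigma> t (\<not> my_turn) (h @ [(v, S')]) S') True" for v t
  have sub: "set_pmf ?M \<subseteq> ?S"
    using \<sigma> lr by (auto simp: strategies_def)
  have step: "pmf (play ?E \<sigma> t my_turn h ?S) True = (\<Sum>v\<in>?S. pmf ?M v * g v t)" for t
  proof -
    have "pmf (play ?E \<sigma> t my_turn h ?S) True = (\<integral>v. pmf (if v = t then return_pmf my_turn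
       else if finite ?S \<and> v \<in> ?S then (let S' = component ?E (?S - {v}) t in
         play ?E \<sigma> t (\<not> my_turn) (h @ [(v, S')]) S') else return_pmf False) True \<partial>?M)"
      by (subst play.simps) (simp only: pmf_bind)
    also have "\<dots> = (\<Sum>v\<in>?S. pmf ?M v * g v t)"
      by (subst integral_measure_pmf_real[of ?S])
         (use sub in \<open>auto simp: g_def mult.commute intro!: sum.cong\<close>)
    finally show ?thesis .
  qed
  have inner: "(\<Sum>t\<in>?S. g v t) = of_bool my_turn
          + interval_score n \<sigma> (\<not> my_turn) (h @ [(v, {l..<v})]) l v
          + interval_score n \<sigma> (\<not> my_turn) (h @ [(v, {Suc v..<r})]) (Suc v) r" if v: "v \<in> ?S" for v
  proof -
    have split: "?S = {v} \<union> {l..<v} \<union> {Suc v..<r}" using v by auto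
    have left: "component ?E (?S - {v}) t = {l..<v}" if "t \<in> {l..<v}" for t
      by (rule component_path_interval) (use that v lr in auto)
    have right: "component ?E (?S - {v}) t = {Suc v..<r}" if "t \<in> {Suc v..<r}" for t
      by (rule component_path_interval) (use that v lr in auto)
    have "(\<Sum>t\<in>?S. g v t) = g v v + (\<Sum>t\<in>{l..<v}. g v t) + (\<Sum>t\<in>{Suc v..<r}. g v t)"
      by (subst split, subst sum.union_disjoint) auto
    also have "g v v = of_bool my_turn" by (simp add: g_def)
    also have "(\<Sum>t\<in>{l..<v}. g v t)
        = interval_score n \<sigma> (\<not> my_turn) (h @ [(v, {l..<v})]) l v"
      unfolding interval_score_def
      by (rule sum.cong) (use left in \<open>auto simp: g_def Let_def\<close>)
    also have "(\<Sum>t\<in>{Suc v..<r}. g v t)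
        = interval_score n \<sigma> (\<not> my_turn) (h @ [(v, {Suc v..<r})]) (Suc v) r"
      unfolding interval_score_def
      by (rule sum.cong) (use right in \<open>auto simp: g_def Let_def\<close>)
    finally show ?thesis .
  qed
  have "interval_score n \<sigma> my_turn h l r = (\<Sum>v\<in>?S. pmf ?M v * (\<Sum>t\<in>?S. g v t))"
    unfolding interval_score_def step by (subst sum.swap) (simp add: sum_distrib_left)
  then show ?thesis by (simp only: inner cong: sum.cong)
qed

text \<open>Over a uniform guess, the left and the right piece each take every size below the length of the
  interval exactly once.\<close>
lemma average_pieces:
  assumes "l < r"
  shows "(\<Sum>v\<in>{l..<r}. (first_score (v - l) + first_score (r - Suc v)) / real (r - l))
    = second_score (r - l)"
proof -
  have 1: "(\<Sum>v\<in>{l..<r}. first_score (v - l)) = (\<Sum>k<r - l. first_score k)"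
    by (rule sum.reindex_bij_witness[of _ "\<lambda>k. k + l" "\<lambda>v. v - l"]) auto
  have 2: "(\<Sum>v\<in>{l..<r}. first_score (r - Suc v)) = (\<Sum>k<r - l. first_score k)"
    by (rule sum.reindex_bij_witness[of _ "\<lambda>k. r - Suc k" "\<lambda>v. r - Suc v"]) auto
  show ?thesis
    unfolding sum_divide_distrib[symmetric] sum.distrib 1 2
    using second_score_sum[of "r - l"] assms by (simp add: field_simps)
qed

text \<open>
  The bound holds for every history, so a strategy gains nothing from its dependence on it. On the
  player's own turn the score is an average, over the guess, of quantities that superadditivity
  bounds by \<open>1 + b\<^sub>m\<^sub>-\<^sub>1\<close> for an interval of \<open>m\<close> vertices, so randomising does not help either.
\<close>
lemma interval_score_le:
  assumes \<sigma>: "\<sigma> \<in> strategies"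
  shows "1 \<le> l \<Longrightarrow> l \<le> r \<Longrightarrow> r \<le> Suc n \<Longrightarrow>
    interval_score n \<sigma> my_turn h l r \<le> (if my_turn then first_score (r - l) else second_score (r - l))"
proof (induction "r - l" arbitrary: l r my_turn h rule: less_induct)
  case less
  show ?case
  proof (cases "l = r")
    case True
    then show ?thesis by (simp add: interval_score_def first_score_def)
  next
    case False
    then have lr: "1 \<le> l" "l < r" "r \<le> Suc n" using less.prems by auto
    let ?S = "{l..<r}"
    note step = interval_score_step[OF \<sigma> lr, of my_turn h]
    have L: "interval_score n \<sigma> (\<not> my_turn) (h @ [(v, {l..<v})]) l v
        \<le> (if \<not> my_turn then first_score (v - l) else second_score (v - l))" if "v \<in> ?S" for v
      by (rule less.hyps) (use that lr in auto)
    have R: "interval_score n \<sigma> (\<not> my_turn) (h @ [(v, {Suc v..<r})]) (Suc v) r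
        \<le> (if \<not> my_turn then first_score (r - Suc v) else second_score (r - Suc v))" if "v \<in> ?S" for v
      by (rule less.hyps) (use that lr in auto)
    show ?thesis
    proof (cases my_turn)
      case True
      have "interval_score n \<sigma> my_turn h l r \<le> (\<Sum>v\<in>?S. pmf (\<sigma> h ?S) v * first_score (r - l))"
        unfolding step
      proof (rule sum_mono)
        fix v assume v: "v \<in> ?S"
        have "second_score (v - l) + second_score (r - Suc v) \<le> second_score (r - l - 1)"
          using second_score_superadditive[of "v - l" "r - Suc v"] v by simp
        then show "pmf (if my_turn then \<sigma> h ?S else pmf_of_set ?S) v *
            (of_bool my_turn + interval_score n \<sigma> (\<not> my_turn) (h @ [(v, {l..<v})]) l v
              + interval_score n \<sigma> (\<not> my_turn) (h @ [(v, {Suc v..<r})]) (Suc v) r)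
            \<le> pmf (\<sigma> h ?S) v * first_score (r - l)"
          using L[OF v] R[OF v] True lr by (auto simp: first_score_def intro!: mult_left_mono)
      qed
      also have "\<dots> = first_score (r - l)"
      proof -
        have "set_pmf (\<sigma> h ?S) \<subseteq> ?S" using \<sigma> lr by (auto simp: strategies_def)
        then show ?thesis by (simp add: sum_distrib_right[symmetric] sum_pmf_eq_1)
      qed
      finally show ?thesis using True by simp
    next
      case False
      have "interval_score n \<sigma> my_turn h l r
          \<le> (\<Sum>v\<in>?S. (first_score (v - l) + first_score (r - Suc v)) / real (r - l))"
        unfolding step
      proof (rule sum_mono)
        fix v assume v: "v \<in> ?S"
        then have "pmf (pmf_of_set ?S) v = 1 / real (r - l)" by (simp add: pmf_of_set)
        then show "pmf (if my_turn then \<sigma> h ?S else pmf_of_set ?S) v *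
            (of_bool my_turn + interval_score n \<sigma> (\<not> my_turn) (h @ [(v, {l..<v})]) l v
              + interval_score n \<sigma> (\<not> my_turn) (h @ [(v, {Suc v..<r})]) (Suc v) r)
            \<le> (first_score (v - l) + first_score (r - Suc v)) / real (r - l)"
          using L[OF v] R[OF v] False lr by (auto simp: divide_simps)
      qed
      then show ?thesis using False unfolding average_pieces[OF lr(2)] by simp
    qed
  qed
qed

definition leftmost :: "nat strategy" where
  "leftmost h S = return_pmf (Min S)"

lemma leftmost_strategy: "leftmost \<in> strategies"
  by (auto simp: strategies_def leftmost_def)

text \<open>The same induction with equalities: an endpoint leaves one piece of size \<open>m - 1\<close> and an empty
  one, which realises \<open>1 + b\<^sub>m\<^sub>-\<^sub>1\<close>.\<close>
lemma interval_score_leftmost: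
  "1 \<le> l \<Longrightarrow> l \<le> r \<Longrightarrow> r \<le> Suc n \<Longrightarrow>
    interval_score n leftmost my_turn h l r
      = (if my_turn then first_score (r - l) else second_score (r - l))"
proof (induction "r - l" arbitrary: l r my_turn h rule: less_induct)
  case less
  show ?case
  proof (cases "l = r")
    case True
    then show ?thesis by (simp add: interval_score_def first_score_def)
  next
    case False
    then have lr: "1 \<le> l" "l < r" "r \<le> Suc n" using less.prems by auto
    let ?S = "{l..<r}"
    note step = interval_score_step[OF leftmost_strategy lr, of my_turn h]
    have L: "interval_score n leftmost (\<not> my_turn) (h @ [(v, {l..<v})]) l v
        = (if \<not> my_turn then first_score (v - l) else second_score (v - l))" if "v \<in> ?S" for v
      by (rule less.hyps) (use that lr in auto)
    have R: "interval_score n leftmost (\<not> my_turn) (h @ [(v, {Suc v..<r})]) (Suc v) r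
        = (if \<not> my_turn then first_score (r - Suc v) else second_score (r - Suc v))" if "v \<in> ?S" for v
      by (rule less.hyps) (use that lr in auto)
    show ?thesis
    proof (cases my_turn)
      case True
      have "Min ?S = l" using lr by (intro Min_eqI) auto
      then have "interval_score n leftmost my_turn h l r
          = (\<Sum>v\<in>?S. if v = l then first_score (r - l) else 0)"
        unfolding step using L R True lr
        by (intro sum.cong) (auto simp: leftmost_def first_score_def indicator_def)
      then show ?thesis using True lr by simp
    next
      case False
      have "interval_score n leftmost my_turn h l r
          = (\<Sum>v\<in>?S. (first_score (v - l) + first_score (r - Suc v)) / real (r - l))"
        unfolding step using L R False lr by (intro sum.cong) auto
      then show ?thesis using False unfolding average_pieces[OF lr(2)] by simp
    qed
  qed
qed

lemma pmf_game_path: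
  assumes "n \<ge> 1"
  shows "pmf (tree_search_game (path_verts n) (path_edges n) \<sigma> my_turn) True
    = interval_score n \<sigma> my_turn [] 1 (Suc n) / real n"
  using assms
  by (simp add: tree_search_game_def path_verts_def pmf_bind integral_pmf_of_set interval_score_def
      atLeastLessThanSuc_atLeastAtMost)

lemma win_prob_path:
  assumes "n \<ge> 1"
  shows "(SUP \<sigma>\<in>strategies. pmf (tree_search_game (path_verts n) (path_edges n) \<sigma> my_turn) True)
    = (if my_turn then first_score n else second_score n) / real n"
proof (rule cSup_eq_maximum)
  show "(if my_turn then first_score n else second_score n) / real n
    \<in> (\<lambda>\<sigma>. pmf (tree_search_game (path_verts n) (path_edges n) \<sigma> my_turn) True) ` strategies"
    using interval_score_leftmost[of 1 "Suc n" n my_turn "[]"] assms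
    by (intro image_eqI[OF _ leftmost_strategy]) (simp add: pmf_game_path)
next
  fix x
  assume "x \<in> (\<lambda>\<sigma>. pmf (tree_search_game (path_verts n) (path_edges n) \<sigma> my_turn) True) ` strategies"
  then obtain \<sigma> where "\<sigma> \<in> strategies" "x = interval_score n \<sigma> my_turn [] 1 (Suc n) / real n"
    using assms by (auto simp: pmf_game_path)
  then show "x \<le> (if my_turn then first_score n else second_score n) / real n"
    using interval_score_le[of \<sigma> 1 "Suc n" n my_turn "[]"] assms by (auto intro: divide_right_mono)
qed

theorem theorem4p8:
  fixes n :: nat
  assumes "n \<ge> 1"
  shows "win_prob_first (path_verts n) (path_edges n) =
           1 / 2 - 1 / real n * ((- 2) ^ n / fact n)
             + (real n + 2) / (2 * real n) * (\<Sum>j=0..n. (- 2) ^ j / fact j)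
       \<and> win_prob_second (path_verts n) (path_edges n) =
           (real n - 1) / (2 * real n) - 1 / real n * ((- 2) ^ n / fact n)
             + (real n + 3) / (2 * real n) * (\<Sum>j=0..n. (- 2) ^ j / fact j)"
proof -
  define x :: real where "x = (- 2) ^ n / fact n"
  define s :: real where "s = (\<Sum>j=0..n. (- 2) ^ j / fact j)"
  have n: "real n \<noteq> 0" using assms by simp
  show ?thesis
    unfolding win_prob_first_def win_prob_second_def win_prob_path[OF assms] if_True if_False
      first_score_closed[OF assms] second_score_closed x_def[symmetric] s_def[symmetric]
    using n by (simp add: field_simps)
qed

end
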